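(* Let $p>3$ be a prime. Then $b_{p-1}\equiv81^{p-1}\pmod{p^3}$.
   Context: The Almkvist–Zudilin numbers are $b_n=\sum_{k=0}^{\lfloor n/3\rfloor}\binom{2k}{k}\binom{3k}{k}\binom{n}{3k}\binom{n+k}{k}(-3)^{n-3k}$ for $n\ge0$. *)

theory Defs
  imports "HOL-Number_Theory.Number_Theory"
begin

definition almkvist_zudilin :: "nat \<Rightarrow> int" where
  "almkvist_zudilin n =
     (\<Sum>k=0..n div 3. int ((2 * k) choose k) * int ((3 * k) choose k) * int (n choose (3 * k))
        * int ((n + k) choose k) * (-3) ^ (n - 3 * k))"

end

(*
  Let P = p, viewed in the localization of the rationals at p, and N = p div 3. Writing
  A = 1 - 2P/3 + N, which is whichever of (1 - p)/3, (2 - p)/3 is not the integer -N, the summands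
  of the Almkvist-Zudilin number at p - 1 are 3^(p-1) times those of the balanced series
    4F3(-N, A, 1 - P/3, P; 1, 1, 1; 1).
  All of them but the first contain the factor P, while
  (1 - P/3)_k (1 + P/3)_k = k!^2 (mod p^2). Hence modulo p^3 one may replace (1 - P/3)_k / k! by
  k! / (1 + P/3)_k, which leaves a 3F2 that is still balanced; the Pfaff-Saalschuetz theorem
  evaluates it as a product R over 1 <= i <= N.

  Multiplication by 3 permutes the nonzero residues mod p. This gives the exact formula
  3^(p-1) = F1 F2, with F1 a product over i <= N and F2 one over N < i < p - N. Factor by factor
  R = F1^3 (1 + (2/3) p^2 (sum of 1/i^2)), and pairing i with p - i yields
  F2 = 1 + (2/9) p^2 (sum of 1/i^2), since the sum of all 1/i^2 over 0 < i < p vanishes mod p.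
  Thus R = (F1 F2)^3 and the number is (3^(p-1))^4, all modulo p^3.
*)
theory Submission
  imports Defs
begin

section \<open>The Pfaff--Saalschuetz theorem\<close>

text \<open>Creative telescoping: consecutive rows of the Saalschuetz sum obey a first-order
  recurrence in \<open>n\<close>, and the partial defect of that recurrence collapses to a single
  product. Having this product for every \<open>m\<close> makes an induction on \<open>m\<close>
  possible.\<close>

lemma saalschuetz_partial_sum:
  fixes a b c :: "'a::field_char_0"
  assumes "m \<le> n"
  defines "F \<equiv> \<lambda>n k. of_nat (n choose k) * pochhammer a k * pochhammer b k
      * pochhammer (c + of_nat k) (n - k) * pochhammer (c - a - b) (n - k)"
  shows "(\<Sum>k\<le>m. F (Suc n) k) - (c - a + of_nat n) * (c - b + of_nat n) * (\<Sum>k\<le>m. F n k)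
    = - (of_nat (n choose m) * pochhammer a (Suc m) * pochhammer b (Suc m)
          * pochhammer (c + of_nat m) (n - m) * pochhammer (c - a - b) (n - m))"
  using assms(1)
proof (induction m)
  case 0
  show ?case
    by (simp add: F_def pochhammer_Suc algebra_simps)
next
  case (Suc m)
  then obtain j where n: "n = Suc m + j"
    using le_Suc_ex by blast
  \<comment> \<open>The absorption identity expresses every binomial coefficient of the step through
    \<open>B\<close>.\<close>
  define B where "B = (of_nat (n choose m) :: 'a)"
  have "Suc m * (n choose Suc m) = (n - m) * (n choose m)"
    by (metis binomial_absorb_comp binomial_absorption mult.commute)
  then have "of_nat (Suc m * (n choose Suc m)) = (of_nat (Suc j * (n choose m)) :: 'a)"
    using n by (simp del: of_nat_Suc)
  then have "of_nat (Suc m) * of_nat (n choose Suc m) = of_nat (Suc j) * (of_nat (n choose m) :: 'a)"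
    by (simp only: of_nat_mult)
  then have C: "of_nat (n choose Suc m) = of_nat (Suc j) * B / of_nat (Suc m)"
    by (simp only: B_def nonzero_eq_divide_eq of_nat_neq_0 not_False_eq_True mult.commute)
  have D: "of_nat (Suc n choose Suc m) = B + of_nat (Suc j) * B / of_nat (Suc m)"
    unfolding binomial_Suc_Suc of_nat_add C by (simp only: B_def)
  \<comment> \<open>\<open>P * Q\<close> is the Pochhammer product shared by all four terms of the
    step; only linear factors remain beside it.\<close>
  define P where "P = pochhammer a (Suc m) * pochhammer b (Suc m)"
  define Q where "Q = pochhammer (c + of_nat (Suc m)) j * pochhammer (c - a - b) j"
  have 1: "F (Suc n) (Suc m) = (B + of_nat (Suc j) * B / of_nat (Suc m)) * P * Q
      * (c + of_nat n) * (c - a - b + of_nat j)"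
    unfolding F_def D
    by (simp add: P_def Q_def n pochhammer_Suc[of _ j] add_ac mult_ac)
      
  have 2: "F n (Suc m) = (of_nat (Suc j) * B / of_nat (Suc m)) * P * Q"
    unfolding F_def C by (simp add: P_def Q_def n)
  have 3: "of_nat (n choose m) * pochhammer a (Suc m) * pochhammer b (Suc m)
          * pochhammer (c + of_nat m) (n - m) * pochhammer (c - a - b) (n - m)
      = B * P * Q * (c + of_nat m) * (c - a - b + of_nat j)"
  proof -
    have "n - m = Suc j" using n by simp
    moreover have "pochhammer (c + of_nat m) (Suc j) = (c + of_nat m) * pochhammer (c + of_nat (Suc m)) j"
      by (simp add: pochhammer_rec add_ac)
    ultimately show ?thesis
      by (simp add: B_def P_def Q_def pochhammer_Suc[of "c - a - b"] mult_ac)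
  qed
  have 4: "of_nat (n choose Suc m) * pochhammer a (Suc (Suc m)) * pochhammer b (Suc (Suc m))
          * pochhammer (c + of_nat (Suc m)) (n - Suc m) * pochhammer (c - a - b) (n - Suc m)
      = (of_nat (Suc j) * B / of_nat (Suc m)) * P * Q * (a + of_nat (Suc m)) * (b + of_nat (Suc m))"
    unfolding C by (simp add: P_def Q_def n pochhammer_Suc[of _ "Suc m"] mult_ac)
  have "(\<Sum>k\<le>Suc m. F (Suc n) k) - (c - a + of_nat n) * (c - b + of_nat n) * (\<Sum>k\<le>Suc m. F n k)
     = - (B * P * Q * (c + of_nat m) * (c - a - b + of_nat j))
       + F (Suc n) (Suc m) - (c - a + of_nat n) * (c - b + of_nat n) * F n (Suc m)"
  proof -
    have "s' + x - X * (s + y) = (s' - X * s) + x - X * y" for s' x X s y :: 'a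
      by (simp add: algebra_simps)
    then show ?thesis using Suc 3 by simp
  qed
  also have "\<dots> = - ((of_nat (Suc j) * B / of_nat (Suc m)) * P * Q * (a + of_nat (Suc m)) * (b + of_nat (Suc m)))"
  proof -
    define M where "M = (of_nat (Suc m) :: 'a)"
    have M: "M \<noteq> 0" unfolding M_def by (simp del: of_nat_Suc)
    have m: "of_nat m = M - 1" and nn: "of_nat n = M + of_nat j" and jj: "of_nat (Suc j) = 1 + (of_nat j :: 'a)"
      by (simp_all add: M_def n)
    \<comment> \<open>The induction step with \<open>P * Q\<close> divided out: a rational identity
      in \<open>M = m + 1\<close> and \<open>J = n - m - 1\<close>.\<close>
    have "- (B * (c + (M - 1)) * (c - a - b + J)) + (B + (1 + J) * B / M) * (c + (M + J)) * (c - a - b + J)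
        - (c - a + (M + J)) * (c - b + (M + J)) * ((1 + J) * B / M)
      = - ((1 + J) * B / M * (a + M) * (b + M))" for J
      using M by (simp add: divide_simps) (simp add: algebra_simps)
    note id = this[of "of_nat j"]
    \<comment> \<open>Hiding the only quotient in \<open>K\<close> lets the factor
      \<open>P * Q\<close> be restored by polynomial algebra alone.\<close>
    define K where "K = (1 + of_nat j) * B / M"
    have "- (B * P * Q * x * y) + (B + K) * P * Q * z * y - w * v * (K * P * Q)
        = - (K * P * Q * g * h)"
      if "- (B * x * y) + (B + K) * z * y - w * v * K = - (K * g * h)" for x y z w v g h
    proof -
      have "- (B * P * Q * x * y) + (B + K) * P * Q * z * y - w * v * (K * P * Q)
          = P * Q * (- (B * x * y) + (B + K) * z * y - w * v * K)"
        by (simp add: algebra_simps)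
      then show ?thesis unfolding that by (simp add: mult_ac)
    qed
    from this[OF id[folded K_def]] show ?thesis
      unfolding 1 2 m nn jj M_def[symmetric] K_def[symmetric] .
  qed
  finally show ?case unfolding 4 .
qed

text \<open>The Pfaff--Saalschuetz sum, with all denominators cleared so that it holds without side conditions.\<close>

lemma saalschuetz:
  fixes a b c :: "'a::field_char_0"
  shows "(\<Sum>k\<le>n. of_nat (n choose k) * pochhammer a k * pochhammer b k
      * pochhammer (c + of_nat k) (n - k) * pochhammer (c - a - b) (n - k))
    = pochhammer (c - a) n * pochhammer (c - b) n"
proof (induction n)
  case (Suc n)
  \<comment> \<open>At \<open>m = n\<close> the telescoped product is exactly the missing top term
    of row \<open>Suc n\<close>, so the full sums satisfy the recurrence without defect.\<close>
  show ?case
    using saalschuetz_partial_sum[of n n a b c] Suc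
    by (simp add: pochhammer_Suc[of "c - a"] pochhammer_Suc[of "c - b"] algebra_simps)
qed simp

section \<open>Rewriting binomial coefficients and Pochhammer symbols\<close>

lemma pochhammer_one_plus: "pochhammer (1 + x) n = (\<Prod>i=1..n. of_nat i + x)"
  for x :: "'a::comm_ring_1"
  by (induction n) (simp_all add: pochhammer_Suc add_ac)

text \<open>The product of binomial coefficient and factorial is a falling factorial, and this is
  its recurrence. Subtracting in the field keeps it valid for \<open>m \<ge> n\<close>, where both
  sides vanish.\<close>

lemma binomial_fact_Suc:
  "of_nat (n choose Suc m) * fact (Suc m) = (of_nat n - of_nat m) * (of_nat (n choose m) * fact m :: 'a::field_char_0)"
  unfolding binomial_gbinomial by (simp add: gbinomial_prod_rev del: fact_Suc)

lemma binomial_add_eq_pochhammer: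
  "of_nat ((n + k) choose k) = (pochhammer (of_nat n + 1) k / fact k :: 'a::field_char_0)"
  unfolding binomial_gbinomial by (simp add: gbinomial_pochhammer' add_ac)

lemma binomial_mult_eq_fact_divide:
  "of_nat (2 * k choose k) * of_nat (3 * k choose k) = (fact (3 * k) / fact k ^ 3 :: 'a::field_char_0)"
  by (simp add: binomial_fact power3_eq_cube)

section \<open>Congruences in the localization at a prime\<close>

locale localization_at_prime =
  fixes p :: nat
  assumes prime_p: "prime p"
begin

definition Zp :: "rat set" where
  "Zp = {of_int a / of_int b | a b. \<not> int p dvd b}"

text \<open>The unit group of the ring \<open>Zp\<close>: the permitted denominators.\<close>

definition Up :: "rat set" where
  "Up = {of_int a / of_int b | a b. \<not> int p dvd a \<and> \<not> int p dvd b}"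

text \<open>Only the difference is constrained; \<open>x\<close> and \<open>y\<close> may be
  arbitrary rationals, so rules for products ask for membership in \<open>Zp\<close>
  separately.\<close>

definition zcong :: "nat \<Rightarrow> rat \<Rightarrow> rat \<Rightarrow> bool" where
  "zcong m x y \<longleftrightarrow> (\<exists>z\<in>Zp. x - y = of_nat p ^ m * z)"

lemma not_dvd_mult: "\<not> int p dvd a \<Longrightarrow> \<not> int p dvd b \<Longrightarrow> \<not> int p dvd a * b"
  using prime_p by (simp add: prime_dvd_mult_iff)

lemma not_dvd_one: "\<not> int p dvd 1"
  using prime_gt_1_nat[OF prime_p] by simp

section \<open>Closure properties of the local ring and its units\<close>

lemma of_int_Zp [simp, intro!]: "of_int a \<in> Zp"
proof -
  have "of_int a = (of_int a / of_int 1 :: rat)" by simp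
  then show ?thesis unfolding Zp_def using not_dvd_one by blast
qed

lemma of_nat_Zp [simp, intro!]: "of_nat a \<in> Zp"
  using of_int_Zp[of "int a"] by simp

lemma const_Zp [simp, intro!]: "0 \<in> Zp" "1 \<in> Zp" "numeral w \<in> Zp"
  using of_int_Zp[of 0] of_int_Zp[of 1] of_int_Zp[of "numeral w"] by simp_all

lemma add_Zp [intro!]:
  assumes "x \<in> Zp" "y \<in> Zp" shows "x + y \<in> Zp"
proof -
  obtain a b c d where 1: "x = of_int a / of_int b" "y = of_int c / of_int d"
    "\<not> int p dvd b" "\<not> int p dvd d"
    using assms unfolding Zp_def by blast
  moreover from 1 have "b \<noteq> 0" "d \<noteq> 0" by auto
  ultimately have "x + y = of_int (a * d + c * b) / of_int (b * d)" by (simp add: field_simps)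
  then show ?thesis unfolding Zp_def using not_dvd_mult[OF 1(3,4)] by blast
qed

lemma mult_Zp [intro!]:
  assumes "x \<in> Zp" "y \<in> Zp" shows "x * y \<in> Zp"
proof -
  obtain a b c d where 1: "x = of_int a / of_int b" "y = of_int c / of_int d"
    "\<not> int p dvd b" "\<not> int p dvd d"
    using assms unfolding Zp_def by blast
  then have "x * y = of_int (a * c) / of_int (b * d)" by simp
  then show ?thesis unfolding Zp_def using not_dvd_mult[OF 1(3,4)] by blast
qed

lemma uminus_Zp [intro!]: "x \<in> Zp \<Longrightarrow> - x \<in> Zp"
  using mult_Zp[OF of_int_Zp[of "- 1"], of x] by simp

lemma diff_Zp [intro!]: "x \<in> Zp \<Longrightarrow> y \<in> Zp \<Longrightarrow> x - y \<in> Zp"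
  using add_Zp[of x "- y"] by auto

lemma power_Zp [intro!]: "x \<in> Zp \<Longrightarrow> x ^ n \<in> Zp"
  by (induction n) auto

lemma prod_Zp [intro!]: "(\<And>i. i \<in> I \<Longrightarrow> f i \<in> Zp) \<Longrightarrow> prod f I \<in> Zp"
  by (induction I rule: infinite_finite_induct) auto

lemma sum_Zp [intro!]: "(\<And>i. i \<in> I \<Longrightarrow> f i \<in> Zp) \<Longrightarrow> sum f I \<in> Zp"
  by (induction I rule: infinite_finite_induct) auto

lemma Up_nonzero: "u \<in> Up \<Longrightarrow> u \<noteq> 0"
  unfolding Up_def by auto

lemma Up_Zp: "u \<in> Up \<Longrightarrow> u \<in> Zp"
  unfolding Up_def Zp_def by blast

lemma of_int_Up: "\<not> int p dvd a \<Longrightarrow> of_int a \<in> Up"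
proof -
  assume "\<not> int p dvd a"
  moreover have "of_int a = (of_int a / of_int 1 :: rat)" by simp
  ultimately show ?thesis unfolding Up_def using not_dvd_one by blast
qed

lemma one_Up [simp, intro!]: "1 \<in> Up"
  using of_int_Up[OF not_dvd_one] by simp

lemma of_nat_Up: "0 < i \<Longrightarrow> i < p \<Longrightarrow> of_nat i \<in> Up"
  using of_int_Up[of "int i"] nat_dvd_not_less[of i p] by simp

lemma divide_Zp [intro!]:
  assumes "x \<in> Zp" "u \<in> Up" shows "x / u \<in> Zp"
proof -
  obtain a b where "u = of_int a / of_int b" "\<not> int p dvd a"
    using assms unfolding Up_def by blast
  then have "inverse u \<in> Zp" unfolding Zp_def by auto
  then show ?thesis using assms by (auto simp: divide_inverse)
qed

lemma mult_Up [intro!]: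
  assumes "x \<in> Up" "y \<in> Up" shows "x * y \<in> Up"
proof -
  obtain a b c d where 1: "x = of_int a / of_int b" "y = of_int c / of_int d"
    "\<not> int p dvd b" "\<not> int p dvd d" "\<not> int p dvd a" "\<not> int p dvd c"
    using assms unfolding Up_def by blast
  then have "x * y = of_int (a * c) / of_int (b * d)" by simp
  then show ?thesis unfolding Up_def using not_dvd_mult[OF 1(3,4)] not_dvd_mult[OF 1(5,6)] by blast
qed

lemma power_Up [intro!]: "x \<in> Up \<Longrightarrow> x ^ n \<in> Up"
  by (induction n) auto

lemma prod_Up [intro!]: "(\<And>i. i \<in> I \<Longrightarrow> f i \<in> Up) \<Longrightarrow> prod f I \<in> Up"
  by (induction I rule: infinite_finite_induct) auto

text \<open>Being a unit depends only on the residue modulo \<open>p\<close>. This makes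
  denominators such as \<open>3 * i - p\<close> or \<open>i + p / 3\<close> admissible.\<close>

lemma add_p_mult_Up:
  assumes "u \<in> Up" "z \<in> Zp" shows "u + of_nat p * z \<in> Up"
proof -
  obtain a b c d where 1: "u = of_int a / of_int b" "z = of_int c / of_int d"
    "\<not> int p dvd b" "\<not> int p dvd d" "\<not> int p dvd a"
    using assms unfolding Up_def Zp_def by blast
  from 1 have "b \<noteq> 0" "d \<noteq> 0" by auto
  then have "u + of_nat p * z = of_int (a * d + int p * (c * b)) / of_int (b * d)"
    unfolding 1(1,2) by (simp add: field_simps)
  moreover have "\<not> int p dvd a * d + int p * (c * b)"
    using not_dvd_mult[OF 1(5,4)] by (simp add: dvd_add_left_iff)
  ultimately show ?thesis unfolding Up_def using not_dvd_mult[OF 1(3,4)] by blast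
qed

section \<open>Calculus of congruences modulo powers of the prime\<close>

lemma zcongI: "x = y + of_nat p ^ m * z \<Longrightarrow> z \<in> Zp \<Longrightarrow> zcong m x y"
  unfolding zcong_def by auto

lemma zcongE:
  assumes "zcong m x y" obtains z where "z \<in> Zp" "x = y + of_nat p ^ m * z"
  using assms unfolding zcong_def by (metis add_diff_cancel_left' add_diff_eq)

lemma zcong_refl [simp]: "zcong m x x"
  by (rule zcongI[where z = 0]) auto

lemma zcong_sym: "zcong m x y \<Longrightarrow> zcong m y x"
  by (auto elim!: zcongE intro: zcongI[where z = "- z" for z])

lemma zcong_add:
  assumes "zcong m x y" "zcong m x' y'"
  shows "zcong m (x + x') (y + y')"
proof -
  obtain z where "z \<in> Zp" "x = y + of_nat p ^ m * z"
    using assms(1) by (rule zcongE)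
  moreover obtain z' where "z' \<in> Zp" "x' = y' + of_nat p ^ m * z'"
    using assms(2) by (rule zcongE)
  ultimately show ?thesis
    by (intro zcongI[where z = "z + z'"]) (auto simp: algebra_simps)
qed

lemma zcong_trans [trans]: "zcong m x y \<Longrightarrow> zcong m y z \<Longrightarrow> zcong m x z"
  using zcong_add[of m x y y z] by (simp add: zcong_def)

lemma zcong_mult:
  assumes "zcong m x y" "zcong m x' y'" "y \<in> Zp" "y' \<in> Zp"
  shows "zcong m (x * x') (y * y')"
proof -
  obtain z where "z \<in> Zp" "x = y + of_nat p ^ m * z"
    using assms(1) by (rule zcongE)
  moreover obtain z' where "z' \<in> Zp" "x' = y' + of_nat p ^ m * z'"
    using assms(2) by (rule zcongE)
  ultimately show ?thesis using assms(3,4)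
    by (intro zcongI[where z = "z * y' + y * z' + of_nat p ^ m * z * z'"])
      (auto simp: algebra_simps)
qed

lemma zcong_power: "zcong m x y \<Longrightarrow> y \<in> Zp \<Longrightarrow> zcong m (x ^ n) (y ^ n)"
  by (induction n) (auto intro!: zcong_mult)

lemma zcong_sum: "(\<And>i. i \<in> I \<Longrightarrow> zcong m (f i) (g i)) \<Longrightarrow> zcong m (sum f I) (sum g I)"
  by (induction I rule: infinite_finite_induct) (auto intro: zcong_add)

text \<open>The way back to the integers: the denominator of the quotient is coprime to
  \<open>p ^ m\<close> and can be cancelled.\<close>

lemma zcong_of_int: "zcong m (of_int x) (of_int y) \<Longrightarrow> [x = y] (mod int p ^ m)"
proof -
  assume "zcong m (of_int x) (of_int y)"
  then obtain z where z: "z \<in> Zp" "of_int x = of_int y + of_nat p ^ m * z" by (rule zcongE)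
  then obtain a b where ab: "z = of_int a / of_int b" "\<not> int p dvd b" unfolding Zp_def by blast
  then have "b \<noteq> 0" by auto
  then have "of_int ((x - y) * b) = (of_int (int p ^ m * a) :: rat)"
    using z ab by (simp add: field_simps)
  then have "int p ^ m dvd (x - y) * b" by (metis dvd_triv_left of_int_eq_iff)
  moreover have "coprime (int p ^ m) b"
    using prime_p ab by (simp add: prime_imp_coprime)
  ultimately show ?thesis by (simp add: cong_iff_dvd_diff coprime_dvd_mult_left_iff)
qed

text \<open>Since \<open>m \<le> 2 * l\<close>, products of two correction terms vanish modulo
  \<open>p ^ m\<close>, so the corrections simply add up.\<close>

lemma zcong_prod_first_order:
  assumes "finite I" "\<And>i. i \<in> I \<Longrightarrow> u i \<in> Zp" "m \<le> 2 * l"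
    "\<And>i. i \<in> I \<Longrightarrow> zcong m (f i) (1 + of_nat p ^ l * u i)"
  shows "zcong m (prod f I) (1 + of_nat p ^ l * sum u I)"
  using assms
proof (induction I rule: finite_induct)
  case (insert i I)
  have "zcong m (prod f (insert i I)) ((1 + of_nat p ^ l * u i) * (1 + of_nat p ^ l * sum u I))"
    using insert by (auto intro!: zcong_mult)
  also have "zcong m \<dots> (1 + of_nat p ^ l * sum u (insert i I))"
  proof (rule zcongI)
    have "of_nat p ^ l * of_nat p ^ l = (of_nat p ^ m * of_nat p ^ (2 * l - m) :: rat)"
      using insert.prems by (simp flip: power_add mult_2)
    then show "(1 + of_nat p ^ l * u i) * (1 + of_nat p ^ l * sum u I)
      = 1 + of_nat p ^ l * sum u (insert i I) + of_nat p ^ m * (of_nat p ^ (2 * l - m) * (u i * sum u I))"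
      using insert(1,2) by (simp add: algebra_simps)
  qed (use insert in auto)
  finally show ?case .
qed simp

end

section \<open>Powers of three modulo the cube of the prime\<close>

locale prime_gt_3 = localization_at_prime +
  assumes p_gt_3: "p > 3"
begin

abbreviation P :: rat where "P \<equiv> of_nat p"

definition N :: nat where "N = p div 3"

lemma p_cases: "p = 3 * N + 1 \<or> p = 3 * N + 2"
proof -
  have "\<not> 3 dvd p" using primes_dvd_imp_eq[of 3 p] prime_p p_gt_3 by auto
  then show ?thesis unfolding N_def by presburger
qed

lemma numeral_Up [simp, intro]: "2 \<in> Up" "3 \<in> Up"
  using of_nat_Up[of 2] of_nat_Up[of 3] p_gt_3 by simp_all

lemma numeral_power_Up [simp, intro]: "8 \<in> Up" "9 \<in> Up" "27 \<in> Up"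
  using power_Up[of 2 3] power_Up[of 3 2] power_Up[of 3 3] by simp_all

lemma three_i_Up: "0 < i \<Longrightarrow> i < p \<Longrightarrow> 3 * of_nat i + of_int e * P \<in> Up"
  using add_p_mult_Up[of "3 * of_nat i" "of_int e"] of_nat_Up[of i] by (auto simp: mult.commute)

lemma i_Up: "0 < i \<Longrightarrow> i < p \<Longrightarrow> of_nat i + of_int e * P \<in> Up"
  using add_p_mult_Up[of "of_nat i" "of_int e"] of_nat_Up[of i] by (auto simp: mult.commute)

section \<open>Multiplication by 3 on the nonzero residues\<close>

lemma bij_triple: "bij_betw (\<lambda>i. 3 * i mod p) {1..<p} {1..<p}"
proof -
  have cop: "coprime 3 p"
    using primes_coprime[of 3 p] prime_p p_gt_3 by simp
  have "inj_on (\<lambda>i. 3 * i mod p) {1..<p}"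
  proof (rule inj_onI)
    fix i j assume "i \<in> {1..<p}" "j \<in> {1..<p}" "3 * i mod p = 3 * j mod p"
    then have "[i = j] (mod p)"
      using cop cong_mult_lcancel_nat[of 3 p i j] unfolding cong_def by blast
    then show "i = j" using \<open>i \<in> _\<close> \<open>j \<in> _\<close> by (simp add: cong_def)
  qed
  moreover have "(\<lambda>i. 3 * i mod p) ` {1..<p} \<subseteq> {1..<p}"
  proof (rule image_subsetI)
    fix i assume i: "i \<in> {1..<p}"
    have "\<not> p dvd 3 * i"
      using i cop coprime_dvd_mult_right_iff[of p 3 i] nat_dvd_not_less[of i p]
      by (simp add: coprime_commute)
    then show "3 * i mod p \<in> {1..<p}" using p_gt_3 by (auto simp: dvd_eq_mod_eq_0)
  qed
  ultimately show ?thesis by (simp add: bij_betw_def endo_inj_surj)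
qed

text \<open>The middle third, where \<open>3 * i\<close> lies between \<open>p\<close> and
  \<open>2 * p\<close>; it is stable under \<open>i \<mapsto> p - i\<close>.\<close>

definition M :: "nat set" where "M = {N<..<p - N}"

lemma low_range: "i \<in> {1..N} \<Longrightarrow> 0 < i \<and> i < p \<and> 3 * i mod p = 3 * i"
  using p_cases by auto

lemma mid_range:
  assumes "i \<in> M" shows "0 < i" "i < p" "3 * i mod p = 3 * i - p" "p < 3 * i" "3 * i < 2 * p"
proof -
  show *: "0 < i" "i < p" "p < 3 * i" "3 * i < 2 * p" using p_cases assms unfolding M_def by auto
  show "3 * i mod p = 3 * i - p" using * by (simp add: mod_if)
qed

lemma high_range: "i \<in> {1..N} \<Longrightarrow> 3 * (p - i) mod p = p - 3 * i"
proof -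
  assume i: "i \<in> {1..N}"
  then have "3 * i < p" "0 < i" using p_cases by auto
  then have "3 * (p - i) = (p - 3 * i) + p * 2" by simp
  then show ?thesis using \<open>3 * i < p\<close> \<open>0 < i\<close> by (simp only: mod_mult_self2) simp
qed

text \<open>The upper third is reindexed by \<open>i \<mapsto> p - i\<close>, so that it runs over
  the same range as the lower one.\<close>

lemma prod_split:
  fixes f :: "nat \<Rightarrow> 'a::comm_monoid_mult"
  shows "prod f {1..<p} = prod f {1..N} * prod f M * prod (\<lambda>i. f (p - i)) {1..N}"
proof -
  have "2 * N < p" using p_cases by auto
  then have "{1..<p} = ({1..N} \<union> M) \<union> {p - N..<p}" unfolding M_def by auto
  moreover have "prod f (({1..N} \<union> M) \<union> {p - N..<p}) = prod f {1..N} * prod f M * prod f {p - N..<p}"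
  proof -
    have "prod f (({1..N} \<union> M) \<union> {p - N..<p}) = prod f ({1..N} \<union> M) * prod f {p - N..<p}"
      using \<open>2 * N < p\<close> unfolding M_def by (intro prod.union_disjoint) auto
    moreover have "prod f ({1..N} \<union> M) = prod f {1..N} * prod f M"
      unfolding M_def by (intro prod.union_disjoint) auto
    ultimately show ?thesis by simp
  qed
  moreover have "prod f {p - N..<p} = prod (\<lambda>i. f (p - i)) {1..N}"
    using \<open>2 * N < p\<close> by (intro prod.reindex_bij_witness[of _ "\<lambda>i. p - i" "\<lambda>i. p - i"]) auto
  ultimately show ?thesis by simp
qed

lemma sum_split:
  fixes f :: "nat \<Rightarrow> 'a::comm_monoid_add"
  shows "sum f {1..<p} = sum f {1..N} + sum f M + sum (\<lambda>i. f (p - i)) {1..N}"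
proof -
  have "2 * N < p" using p_cases by auto
  then have "{1..<p} = ({1..N} \<union> M) \<union> {p - N..<p}" unfolding M_def by auto
  moreover have "sum f (({1..N} \<union> M) \<union> {p - N..<p}) = sum f {1..N} + sum f M + sum f {p - N..<p}"
  proof -
    have "sum f (({1..N} \<union> M) \<union> {p - N..<p}) = sum f ({1..N} \<union> M) + sum f {p - N..<p}"
      using \<open>2 * N < p\<close> unfolding M_def by (intro sum.union_disjoint) auto
    moreover have "sum f ({1..N} \<union> M) = sum f {1..N} + sum f M"
      unfolding M_def by (intro sum.union_disjoint) auto
    ultimately show ?thesis by simp
  qed
  moreover have "sum f {p - N..<p} = sum (\<lambda>i. f (p - i)) {1..N}"
    using \<open>2 * N < p\<close> by (intro sum.reindex_bij_witness[of _ "\<lambda>i. p - i" "\<lambda>i. p - i"]) auto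
  ultimately show ?thesis by simp
qed

section \<open>An exact factorization of \<open>3 ^ (p - 1)\<close>\<close>

definition F1 :: rat where "F1 = (\<Prod>i=1..N. 3 * (of_nat i - P) / (3 * of_nat i - P))"
definition F2 :: rat where "F2 = (\<Prod>i\<in>M. 3 * of_nat i / (3 * of_nat i - P))"

text \<open>The quotient of the product of all \<open>3 * i\<close> by the product of their residues
  is \<open>3 ^ (p - 1)\<close>, because the residues multiply to \<open>(p - 1)!\<close>. The lower
  third contributes 1, the upper third \<open>F1\<close> and the middle third
  \<open>F2\<close>.\<close>

lemma three_power_eq: "3 ^ (p - 1) = F1 * F2"
proof -
  define L :: rat where "L = (\<Prod>i=1..N. 3 * of_nat i)"
  define C D :: rat where "C = (\<Prod>i\<in>M. 3 * of_nat i)" and "D = (\<Prod>i\<in>M. 3 * of_nat i - P)"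
  define G H :: rat where "G = (\<Prod>i=1..N. 3 * (of_nat i - P))" and "H = (\<Prod>i=1..N. 3 * of_nat i - P)"
  have "(\<Prod>i\<in>{1..<p}. of_nat i :: rat) = (\<Prod>i\<in>{1..<p}. of_nat (3 * i mod p))"
    by (rule prod.reindex_bij_betw[OF bij_triple, symmetric])
  also have "\<dots> = L * D * (\<Prod>i=1..N. P - 3 * of_nat i)"
    unfolding prod_split L_def D_def
  proof (intro arg_cong2[of _ _ _ _ "(*)"] prod.cong refl)
    fix i assume "i \<in> {1..N}"
    then show "rat_of_nat (3 * i mod p) = 3 * of_nat i" using low_range by simp
  next
    fix i assume "i \<in> M"
    then show "rat_of_nat (3 * i mod p) = 3 * of_nat i - P"
      using mid_range[of i] by (simp add: of_nat_diff)
  next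
    fix i assume i: "i \<in> {1..N}"
    then have "3 * i \<le> p" using p_cases by auto
    then show "rat_of_nat (3 * (p - i) mod p) = P - 3 * of_nat i"
      using high_range[OF i] by (simp add: of_nat_diff)
  qed
  also have "(\<Prod>i=1..N. P - 3 * of_nat i) = (-1) ^ N * H"
    using prod_uminus[of "\<lambda>i. 3 * rat_of_nat i - P" "{1..N}"] unfolding H_def by simp
  finally have 1: "(\<Prod>i\<in>{1..<p}. of_nat i :: rat) = L * D * ((-1) ^ N * H)" .
  have "3 ^ (p - 1) * (\<Prod>i\<in>{1..<p}. of_nat i :: rat) = (\<Prod>i\<in>{1..<p}. 3 * of_nat i)"
    by (simp add: prod.distrib)
  also have "\<dots> = L * C * (\<Prod>i=1..N. 3 * of_nat (p - i))"
    unfolding prod_split L_def C_def by simp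
  also have "(\<Prod>i=1..N. 3 * rat_of_nat (p - i)) = (\<Prod>i=1..N. - (3 * (of_nat i - P)))"
    using low_range by (intro prod.cong refl) (simp add: of_nat_diff less_imp_le)
  also have "\<dots> = (-1) ^ N * G"
    using prod_uminus[of "\<lambda>i. 3 * (rat_of_nat i - P)" "{1..N}"] unfolding G_def by simp
  finally have 2: "3 ^ (p - 1) * (L * D * ((-1) ^ N * H)) = L * C * ((-1) ^ N * G)" unfolding 1 .
  have nz: "3 * rat_of_nat i - P \<noteq> 0" if "0 < i" "i < p" for i
    using Up_nonzero[OF three_i_Up[OF that, of "-1"]] by simp
  \<comment> \<open>The lower third \<open>L\<close> and the sign of the reflected upper third occur
    on both sides and cancel.\<close>
  have "L * (-1) ^ N \<noteq> 0" unfolding L_def by auto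
  moreover have "L * (-1) ^ N * (3 ^ (p - 1) * (H * D)) = L * (-1) ^ N * (G * C)"
    using 2 by (simp only: mult_ac)
  ultimately have "3 ^ (p - 1) * (H * D) = G * C"
    by (metis mult_left_cancel)
  moreover have "D \<noteq> 0"
  proof -
    have "\<forall>i\<in>M. 3 * rat_of_nat i - P \<noteq> 0" using nz mid_range(1,2) by blast
    then show ?thesis unfolding D_def by (simp add: M_def)
  qed
  moreover have "H \<noteq> 0"
  proof -
    have "\<forall>i\<in>{1..N}. 3 * rat_of_nat i - P \<noteq> 0" using nz low_range by blast
    then show ?thesis unfolding H_def by simp
  qed
  moreover have "F1 * F2 = (G * C) / (H * D)"
    unfolding F1_def F2_def G_def H_def C_def D_def by (simp only: prod_dividef times_divide_times_eq)
  ultimately show ?thesis by (metis mult_eq_0_iff nonzero_mult_div_cancel_right)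
qed

section \<open>Sums of inverse squares and the factor \<open>F2\<close>\<close>

definition h2 :: rat where "h2 = (\<Sum>i=1..N. 1 / of_nat i ^ 2)"
definition m2 :: rat where "m2 = (\<Sum>i\<in>M. 1 / of_nat i ^ 2)"

lemma inverse_square_Zp: "0 < i \<Longrightarrow> i < p \<Longrightarrow> 1 / of_nat i ^ 2 \<in> Zp"
  using of_nat_Up by auto

lemma h2_Zp: "h2 \<in> Zp"
  unfolding h2_def using low_range by (intro sum_Zp inverse_square_Zp) simp_all

lemma inverse_square_cong:
  assumes "x = y + P * z" "x \<in> Up" "y \<in> Up" "z \<in> Zp"
  shows "zcong 1 (1 / x ^ 2) (1 / y ^ 2)"
proof (rule zcongI)
  show "1 / x ^ 2 = 1 / y ^ 2 + P ^ 1 * (- z * (x + y) / (x ^ 2 * y ^ 2))"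
    using assms(2,3)[THEN Up_nonzero]
    by (simp add: divide_simps) (simp add: assms(1) algebra_simps power2_eq_square)
  show "- z * (x + y) / (x ^ 2 * y ^ 2) \<in> Zp"
    using assms Up_Zp by (intro divide_Zp mult_Zp uminus_Zp add_Zp mult_Up power_Up)
qed

text \<open>Replacing \<open>i\<close> by \<open>3 * i\<close> permutes the summands modulo
  \<open>p\<close> and divides the sum by 9, so 8/9 of the sum vanishes; 8 is a unit.\<close>

lemma sum_inverse_squares: "zcong 1 (\<Sum>i\<in>{1..<p}. 1 / of_nat i ^ 2) 0"
proof -
  define S :: rat where "S = (\<Sum>i\<in>{1..<p}. 1 / of_nat i ^ 2)"
  have "S = (\<Sum>i\<in>{1..<p}. 1 / of_nat (3 * i mod p) ^ 2)"
    unfolding S_def by (rule sum.reindex_bij_betw[OF bij_triple, symmetric])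
  moreover have "zcong 1 \<dots> (\<Sum>i\<in>{1..<p}. 1 / (3 * of_nat i) ^ 2)"
  proof (intro zcong_sum inverse_square_cong)
    fix i assume i: "i \<in> {1..<p}"
    have "rat_of_nat (3 * i) = of_nat (3 * i mod p + p * (3 * i div p))" by simp
    then show "rat_of_nat (3 * i mod p) = 3 * of_nat i + P * - of_nat (3 * i div p)"
      by (simp only: of_nat_add of_nat_mult of_nat_numeral)
    show "rat_of_nat (3 * i mod p) \<in> Up"
      using bij_betwE[OF bij_triple] i by (intro of_nat_Up) (force, auto)
    show "3 * rat_of_nat i \<in> Up" using i of_nat_Up[of i] by auto
  qed auto
  moreover have "(\<Sum>i\<in>{1..<p}. 1 / (3 * of_nat i :: rat) ^ 2) = S / 9"
    unfolding S_def by (simp add: power_mult_distrib sum_divide_distrib mult.commute)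
  ultimately have "zcong 1 S (S / 9)" by (simp only:)
  then obtain z where "z \<in> Zp" "S = S / 9 + P ^ 1 * z" by (rule zcongE)
  then have "S = 0 + P ^ 1 * (9 * z / 8)" "9 * z / 8 \<in> Zp" by auto
  then show ?thesis unfolding S_def by (rule zcongI)
qed

text \<open>Modulo \<open>p\<close> the upper third repeats the lower one, since
  \<open>p - i\<close> and \<open>- i\<close> have the same square.\<close>

lemma two_h2_add_m2: "zcong 1 (2 * h2 + m2) 0"
proof -
  have "zcong 1 (\<Sum>i=1..N. 1 / rat_of_nat (p - i) ^ 2) h2"
    unfolding h2_def
  proof (intro zcong_sum)
    fix i assume i: "i \<in> {1..N}"
    then have "i < p" using low_range by simp
    have "zcong 1 (1 / rat_of_nat (p - i) ^ 2) (1 / (- of_nat i) ^ 2)"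
    proof (rule inverse_square_cong)
      show "rat_of_nat (p - i) = - of_nat i + P * 1" using \<open>i < p\<close> by (simp add: of_nat_diff)
      show "rat_of_nat (p - i) \<in> Up" using i \<open>i < p\<close> by (intro of_nat_Up) auto
      show "- rat_of_nat i \<in> Up"
        using of_int_Up[of "- int i"] nat_dvd_not_less[of i p] i \<open>i < p\<close> by auto
    qed auto
    then show "zcong 1 (1 / rat_of_nat (p - i) ^ 2) (1 / of_nat i ^ 2)" by simp
  qed
  then have "zcong 1 (h2 + m2 + (\<Sum>i=1..N. 1 / rat_of_nat (p - i) ^ 2)) (h2 + m2 + h2)"
    by (intro zcong_add) auto
  from zcong_trans[OF zcong_sym[OF this]] show ?thesis
    using sum_inverse_squares unfolding sum_split h2_def[symmetric] m2_def[symmetric]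
    by (simp add: algebra_simps)
qed

text \<open>Factor the difference of squares. The unit condition on \<open>x + y\<close> selects the
  correct square root.\<close>

lemma zcong_of_square:
  assumes "zcong m (x ^ 2) (y ^ 2)" "x + y \<in> Up"
  shows "zcong m x y"
proof -
  obtain z where z: "z \<in> Zp" "x ^ 2 = y ^ 2 + P ^ m * z" using assms(1) by (rule zcongE)
  then have "(x - y) * (x + y) = P ^ m * z" by (simp add: power2_eq_square algebra_simps)
  then have "x = y + P ^ m * (z / (x + y))" using Up_nonzero[OF assms(2)] by (simp add: field_simps)
  moreover have "z / (x + y) \<in> Zp" using z(1) assms(2) by (rule divide_Zp)
  ultimately show ?thesis by (rule zcongI)
qed

text \<open>The factors of \<open>F2\<close> deviate from 1 at order \<open>P\<close>, too early for
  a first-order expansion modulo \<open>p ^ 3\<close>. In \<open>F2 ^ 2\<close> each factor can be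
  paired with its mirror image, which removes the linear term.\<close>

lemma F2_cong: "zcong 3 F2 (1 + P ^ 2 * (2 / 9 * h2))"
proof (rule zcong_of_square)
  \<comment> \<open>Each factor is exactly 1 plus a multiple of \<open>P\<close>; hence the sum of
    the two candidate roots is 2 modulo \<open>p\<close>, a unit.\<close>
  have "zcong 1 F2 (1 + P ^ 1 * (\<Sum>i\<in>M. 1 / (3 * of_nat i - P)))"
    unfolding F2_def
  proof (rule zcong_prod_first_order)
    fix i assume "i \<in> M"
    then have u: "3 * of_nat i - P \<in> Up" using three_i_Up[of i "-1"] mid_range by simp
    show "zcong 1 (3 * of_nat i / (3 * of_nat i - P)) (1 + P ^ 1 * (1 / (3 * of_nat i - P)))"
      using Up_nonzero[OF u] by (simp add: field_simps)
    show "1 / (3 * of_nat i - P) \<in> Zp" using u by auto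
  qed (auto simp: M_def)
  then obtain z where z: "z \<in> Zp" "F2 = 1 + P * (\<Sum>i\<in>M. 1 / (3 * of_nat i - P)) + P * z"
    by (auto elim: zcongE)
  have s: "(\<Sum>i\<in>M. 1 / (3 * of_nat i - P)) \<in> Zp"
  proof (intro sum_Zp divide_Zp)
    fix i assume "i \<in> M"
    then show "3 * of_nat i - P \<in> Up" using three_i_Up[of i "-1"] mid_range(1,2) by simp
  qed simp
  have "F2 + (1 + P ^ 2 * (2 / 9 * h2))
      = 2 + P * ((\<Sum>i\<in>M. 1 / (3 * of_nat i - P)) + z + P * (2 / 9 * h2))"
    unfolding z(2) by (simp add: algebra_simps power2_eq_square)
  also have "\<dots> \<in> Up"
    using s z(1) h2_Zp by (intro add_p_mult_Up) auto
  finally show "F2 + (1 + P ^ 2 * (2 / 9 * h2)) \<in> Up" .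
next
  have "F2 = (\<Prod>i\<in>M. 3 * of_nat (p - i) / (3 * of_nat (p - i) - P))"
    unfolding F2_def
    by (intro prod.reindex_bij_witness[of _ "\<lambda>i. p - i" "\<lambda>i. p - i"]) (auto simp: M_def)
  then have "F2 ^ 2 = (\<Prod>i\<in>M. 3 * of_nat i / (3 * of_nat i - P) * (3 * of_nat (p - i) / (3 * of_nat (p - i) - P)))"
    unfolding prod.distrib power2_eq_square by (simp only: F2_def)
  also have "zcong 3 \<dots> (1 + P ^ 2 * (\<Sum>i\<in>M. - 2 / 9 * (1 / of_nat i ^ 2)))"
  proof (rule zcong_prod_first_order)
    fix i assume "i \<in> M"
    note i = mid_range[OF this]
    define x where "x = rat_of_nat i"
    have u: "x \<in> Up" "3 * x - P \<in> Up" "3 * x - 2 * P \<in> Up"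
      using three_i_Up[of i "-1"] three_i_Up[of i "-2"] of_nat_Up[of i] i by (simp_all add: x_def)
    show "- 2 / 9 * (1 / of_nat i ^ 2) \<in> Zp" 
      using inverse_square_Zp[OF i(1,2)] by (intro mult_Zp[OF divide_Zp[OF uminus_Zp]]) simp_all
    show "zcong 3 (3 * of_nat i / (3 * of_nat i - P) * (3 * of_nat (p - i) / (3 * of_nat (p - i) - P)))
      (1 + P ^ 2 * (- 2 / 9 * (1 / of_nat i ^ 2)))"
    proof (rule zcongI)
      \<comment> \<open>The left side is \<open>9 * x * (x - P) / (a * b)\<close> with
        \<open>a = 3 * x - P\<close>, \<open>b = 3 * x - 2 * P\<close>, and
        \<open>9 * x * (x - P) = a * b - 2 * P ^ 2\<close>. Replacing \<open>a * b\<close> by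
        \<open>9 * x ^ 2\<close> in the correction leaves the cubic remainder.\<close>
      have "3 * x / (3 * x - P) * (3 * (P - x) / (3 * (P - x) - P))
        = 1 + P ^ 2 * (- 2 / 9 * (1 / x ^ 2)) + P ^ 3 * (- 2 * (9 * x - 2 * P) / (9 * x ^ 2 * (3 * x - P) * (3 * x - 2 * P)))"
      proof -
        have "3 * (P - x) - P = - (3 * x - 2 * P)" by simp
        then have nz: "x \<noteq> 0" "3 * x - P \<noteq> 0" "3 * x - 2 * P \<noteq> 0" "3 * (P - x) - P \<noteq> 0"
          using u[THEN Up_nonzero] by auto
        define a b where "a = 3 * x - P" and "b = 3 * x - 2 * P"
        have b: "3 * (P - x) - P = - b" by (simp add: b_def)
        have eq: "9 * x ^ 2 * (a * b) - 2 * P ^ 2 * (a * b) - P ^ 3 * 2 * (9 * x - 2 * P)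
            = 9 * x * (x - P) * (9 * x ^ 2)"
          unfolding a_def b_def by (simp add: power2_eq_square power3_eq_cube algebra_simps)
        have nz': "x \<noteq> 0" "a \<noteq> 0" "b \<noteq> 0" using nz by (simp_all add: a_def b_def)
        have "1 + P ^ 2 * (- 2 / 9 * (1 / x ^ 2)) + P ^ 3 * (- 2 * (9 * x - 2 * P) / (9 * x ^ 2 * a * b))
          = (9 * x ^ 2 * (a * b) - 2 * P ^ 2 * (a * b) - P ^ 3 * 2 * (9 * x - 2 * P)) / (9 * x ^ 2 * a * b)"
        proof -
          have "1 + P ^ 2 * (- 2 / 9 * (1 / x ^ 2)) + P ^ 3 * (- 2 * g / (9 * x ^ 2 * a * b))
            = (9 * x ^ 2 * (a * b) - 2 * P ^ 2 * (a * b) - P ^ 3 * 2 * g) / (9 * x ^ 2 * a * b)" for g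
            using nz' by (simp add: diff_divide_distrib mult_ac)
          then show ?thesis .
        qed
        also have "\<dots> = 3 * x / a * (3 * (P - x) / (- b))"
          unfolding eq using nz' by (simp add: divide_simps) (simp add: algebra_simps)
        finally show ?thesis unfolding b a_def[symmetric] b_def[symmetric] by (rule sym)
      qed
      then show "3 * of_nat i / (3 * of_nat i - P) * (3 * of_nat (p - i) / (3 * of_nat (p - i) - P))
        = 1 + P ^ 2 * (- 2 / 9 * (1 / of_nat i ^ 2))
          + P ^ 3 * (- 2 * (9 * x - 2 * P) / (9 * x ^ 2 * (3 * x - P) * (3 * x - 2 * P)))"
        using i by (simp add: x_def of_nat_diff)
      show "- 2 * (9 * x - 2 * P) / (9 * x ^ 2 * (3 * x - P) * (3 * x - 2 * P)) \<in> Zp"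
        using u Up_Zp[OF u(1)] by (intro divide_Zp mult_Zp mult_Up power_Up) auto
    qed
  qed (auto simp: M_def)
  also have "(\<Sum>i\<in>M. - 2 / 9 * (1 / rat_of_nat i ^ 2)) = - 2 / 9 * m2"
    unfolding m2_def by (simp add: sum_distrib_left)
  also have "zcong 3 (1 + P ^ 2 * (- 2 / 9 * m2)) ((1 + P ^ 2 * (2 / 9 * h2)) ^ 2)"
  proof -
    obtain z where z: "z \<in> Zp" "2 * h2 + m2 = 0 + P ^ 1 * z"
      using two_h2_add_m2 by (rule zcongE)
    \<comment> \<open>As \<open>m2\<close> is multiplied by \<open>P ^ 2\<close>, knowing it modulo
      \<open>p\<close> is enough.\<close>
    then have m2: "m2 = P * z - 2 * h2" by simp
    show ?thesis
    proof (rule zcongI)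
      show "1 + P ^ 2 * (- 2 / 9 * m2) = (1 + P ^ 2 * (2 / 9 * h2)) ^ 2
          + P ^ 3 * (- 2 / 9 * z - P * (4 / 81 * h2 ^ 2))"
        unfolding m2 by (simp add: power2_eq_square power3_eq_cube algebra_simps)
      have "81 \<in> Up" using power_Up[of 3 4] by simp
      then show "- 2 / 9 * z - P * (4 / 81 * h2 ^ 2) \<in> Zp" using z(1) h2_Zp by auto
    qed
  qed
  finally show "zcong 3 (F2 ^ 2) ((1 + P ^ 2 * (2 / 9 * h2)) ^ 2)" .
qed

text \<open>The Saalschuetz value \<open>(1 - 2P/3)_N (1 - P)_N / (N! (1 + P/3)_N)\<close>, factor
  by factor for comparison with \<open>F1 ^ 3\<close>.\<close>

definition R :: rat where
  "R = (\<Prod>i=1..N. (of_nat i - 2 * P / 3) * (of_nat i - P) / (of_nat i * (of_nat i + P / 3)))"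

lemma R_cong: "zcong 3 (R * 3 ^ (p - 1)) (81 ^ (p - 1))"
proof -
  \<comment> \<open>The quotient of the factor of \<open>R\<close> by the cubed factor of
    \<open>F1\<close>. Its linear terms in \<open>P\<close> cancel: -2/3 - 1 - 1/3 + 2 = 0.\<close>
  define rho :: "nat \<Rightarrow> rat" where "rho = (\<lambda>i. (3 * of_nat i - 2 * P) * (3 * of_nat i - P) ^ 3
    / (27 * of_nat i * (3 * of_nat i + P) * (of_nat i - P) ^ 2))"
  have unit: "rat_of_nat i \<in> Up" "3 * rat_of_nat i - P \<in> Up" "3 * rat_of_nat i + P \<in> Up" "rat_of_nat i - P \<in> Up"
    if "i \<in> {1..N}" for i
    using low_range[OF that] of_nat_Up[of i] three_i_Up[of i "-1"] three_i_Up[of i 1] i_Up[of i "-1"] by simp_all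
  have "R = (\<Prod>i=1..N. (3 * (of_nat i - P) / (3 * of_nat i - P)) ^ 3 * rho i)"
    unfolding R_def
  proof (intro prod.cong refl)
    fix i assume "i \<in> {1..N}"
    define x where "x = rat_of_nat i"
    define a b c d where "a = 3 * x - P" and "b = 3 * x + P" and "c = x - P" and "d = 3 * x - 2 * P"
    have nz: "x \<noteq> 0" "a \<noteq> 0" "b \<noteq> 0" "c \<noteq> 0"
      unfolding a_def b_def c_def x_def using unit[OF \<open>i \<in> _\<close>, THEN Up_nonzero] by blast+
    have thirds: "x - 2 * P / 3 = d / 3" "x + P / 3 = b / 3"
      by (simp_all add: b_def d_def field_simps)
    show "(of_nat i - 2 * P / 3) * (of_nat i - P) / (of_nat i * (of_nat i + P / 3))
       = (3 * (of_nat i - P) / (3 * of_nat i - P)) ^ 3 * rho i"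
      unfolding rho_def x_def[symmetric] a_def[symmetric] b_def[symmetric] c_def[symmetric] thirds d_def[symmetric]
      using nz by (simp add: power2_eq_square power3_eq_cube)
  qed
  then have R: "R = F1 ^ 3 * prod rho {1..N}"
    by (simp add: F1_def prod.distrib prod_power_distrib)
  have "zcong 3 (prod rho {1..N}) (1 + P ^ 2 * (\<Sum>i=1..N. 2 / 3 * (1 / of_nat i ^ 2)))"
  proof (rule zcong_prod_first_order)
    fix i assume i: "i \<in> {1..N}"
    show "2 / 3 * (1 / rat_of_nat i ^ 2) \<in> Zp"
      using inverse_square_Zp[of i] low_range[OF i] by (intro mult_Zp[OF divide_Zp]) simp_all
    define x where "x = rat_of_nat i"
    define a b c where "a = 3 * x - P" and "b = 3 * x + P" and "c = x - P"
    have u: "x \<in> Up" "b \<in> Up" "c \<in> Up"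
      unfolding b_def c_def x_def using unit[OF i] by blast+
    \<comment> \<open>The exact cubic remainder of \<open>rho i\<close> after its quadratic term,
      read off from the polynomial identity \<open>eq\<close> below.\<close>
    define y where "y = (42 * x ^ 2 - 16 * P * x - 18 * P ^ 2) / (27 * x ^ 2 * b * c ^ 2)"
    have "42 * x ^ 2 - 16 * P * x - 18 * P ^ 2 \<in> Zp"
      using Up_Zp[OF u(1)] by (intro diff_Zp mult_Zp power_Zp of_nat_Zp const_Zp)
    then have "y \<in> Zp"
      unfolding y_def using u by (intro divide_Zp mult_Up power_Up) simp_all
    moreover have "rho i = 1 + P ^ 2 * (2 / 3 * (1 / of_nat i ^ 2)) + P ^ 3 * y"
    proof -
      have eq: "27 * x ^ 2 * b * c ^ 2 + 18 * P ^ 2 * (b * c ^ 2) + P ^ 3 * (42 * x ^ 2 - 16 * P * x - 18 * P ^ 2)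
          = (3 * x - 2 * P) * a ^ 3 * x"
        unfolding a_def b_def c_def by (simp add: power2_eq_square power3_eq_cube algebra_simps)
      have nz: "x \<noteq> 0" "b \<noteq> 0" "c \<noteq> 0" using u[THEN Up_nonzero] .
      have "1 + P ^ 2 * (2 / 3 * (1 / x ^ 2)) + P ^ 3 * y
        = (27 * x ^ 2 * b * c ^ 2 + 18 * P ^ 2 * (b * c ^ 2) + P ^ 3 * (42 * x ^ 2 - 16 * P * x - 18 * P ^ 2))
          / (27 * x ^ 2 * b * c ^ 2)"
        unfolding y_def add_divide_distrib using nz by simp
      also have "\<dots> = rho i"
        unfolding eq rho_def x_def[symmetric] a_def[symmetric] b_def[symmetric] c_def[symmetric]
        using nz by (simp add: power2_eq_square)
      finally show ?thesis unfolding x_def by (rule sym)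
    qed
    ultimately show "zcong 3 (rho i) (1 + P ^ 2 * (2 / 3 * (1 / of_nat i ^ 2)))"
      by (intro zcongI)
  qed simp_all
  also have "(\<Sum>i=1..N. 2 / 3 * (1 / rat_of_nat i ^ 2)) = 2 / 3 * h2"
    unfolding h2_def by (simp add: sum_distrib_left)
  \<comment> \<open>The remaining terms of the cube carry \<open>P ^ 4\<close> and
    \<open>P ^ 6\<close>.\<close>
  also have "zcong 3 (1 + P ^ 2 * (2 / 3 * h2)) ((1 + P ^ 2 * (2 / 9 * h2)) ^ 3)"
  proof (rule zcongI)
    show "1 + P ^ 2 * (2 / 3 * h2) = (1 + P ^ 2 * (2 / 9 * h2)) ^ 3
      + P ^ 3 * (- P * (3 * (2 / 9 * h2) ^ 2 + P ^ 2 * (2 / 9 * h2) ^ 3))"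
      by (simp add: power2_eq_square power3_eq_cube field_simps)
    show "- P * (3 * (2 / 9 * h2) ^ 2 + P ^ 2 * (2 / 9 * h2) ^ 3) \<in> Zp"
      using h2_Zp by (intro mult_Zp divide_Zp add_Zp power_Zp uminus_Zp) simp_all
  qed
  also have "zcong 3 \<dots> (F2 ^ 3)"
  proof -
    have "1 + P ^ 2 * (2 / 9 * h2) \<in> Zp"
      using h2_Zp by (intro mult_Zp divide_Zp add_Zp power_Zp) simp_all
    then show ?thesis using zcong_sym zcong_power F2_cong by blast
  qed
  finally have "zcong 3 (F1 ^ 3 * prod rho {1..N} * 3 ^ (p - 1)) (F1 ^ 3 * F2 ^ 3 * 3 ^ (p - 1))"
  proof -
    assume *: "zcong 3 (prod rho {1..N}) (F2 ^ 3)"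
    have F1: "F1 \<in> Zp"
      unfolding F1_def using unit by (intro prod_Zp divide_Zp mult_Zp) (auto intro: Up_Zp)
    have F2: "F2 \<in> Zp"
      unfolding F2_def using three_i_Up[of _ "-1"] mid_range(1,2)
      by (intro prod_Zp divide_Zp mult_Zp) simp_all
    show ?thesis using * F1 F2 by (intro zcong_mult zcong_refl power_Zp mult_Zp const_Zp)
  qed
  also have "F1 ^ 3 * F2 ^ 3 * 3 ^ (p - 1) = (3 ^ (p - 1)) ^ 4"
    unfolding three_power_eq by (simp add: power_mult_distrib eval_nat_numeral)
  also have "\<dots> = (3 ^ 4) ^ (p - 1)"
    by (metis power_mult mult.commute)
  also have "(3 ^ 4 :: rat) = 81"
    by simp
  finally show ?thesis unfolding R .
qed

section \<open>Reduction to a balanced series\<close>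

definition A :: rat where "A = 1 - 2 * P / 3 + of_nat N"

text \<open>Since \<open>(-1) ^ k * (N choose k)\<close> is \<open>(-N)_k / k!\<close>, these are
  the terms of the 4F3.\<close>

definition t :: "nat \<Rightarrow> rat" where
  "t k = (-1) ^ k * of_nat (N choose k) * pochhammer A k * pochhammer P k * pochhammer (1 - P / 3) k / fact k ^ 3"

text \<open>Terms of the 3F2 with upper parameters \<open>-N, A, P\<close> and lower parameters
  \<open>1, 1 + P/3\<close>.\<close>

definition t' :: "nat \<Rightarrow> rat" where
  "t' k = (-1) ^ k * of_nat (N choose k) * pochhammer A k * pochhammer P k / (fact k * pochhammer (1 + P / 3) k)"

text \<open>The left side is a falling factorial of length \<open>3 * k\<close>, taken in blocks of
  three. Each block yields one new factor of the symbols for \<open>-N\<close>, \<open>A\<close> and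
  \<open>1 - P / 3\<close>, and the constant 27.\<close>

lemma binomial_three_k:
  assumes "k \<le> N"
  shows "of_nat (p - 1 choose (3 * k)) * fact (3 * k)
    = (27 ^ k * of_nat (N choose k) * fact k * pochhammer A k * pochhammer (1 - P / 3) k :: rat)"
  using assms
proof (induction k)
  case (Suc k)
  have n: "rat_of_nat (p - 1) = P - 1" using p_gt_3 by (simp add: of_nat_diff)
  \<comment> \<open>One of \<open>P - 1\<close>, \<open>P - 2\<close> equals \<open>3 * N\<close>;
    that factor is \<open>3 * (N - k)\<close> and the other is \<open>- 3 * (A + k)\<close>.\<close>
  have A: "(P - 3 * of_nat k - 1) * (P - 3 * of_nat k - 2)
      = - 9 * (of_nat N - of_nat k) * (A + of_nat k)"
    using p_cases
  proof
    assume "p = 3 * N + 1"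
    then have "P = 3 * of_nat N + 1" by (metis of_nat_1 of_nat_add of_nat_mult of_nat_numeral)
    then show ?thesis unfolding A_def by (simp add: field_simps)
  next
    assume "p = 3 * N + 2"
    then have "P = 3 * of_nat N + 2" by (metis of_nat_add of_nat_mult of_nat_numeral)
    then show ?thesis unfolding A_def by (simp add: field_simps)
  qed
  define X where "X = rat_of_nat (p - 1 choose (3 * k)) * fact (3 * k)"
  have "3 * Suc k = Suc (Suc (Suc (3 * k)))" by simp
  then have "rat_of_nat (p - 1 choose (3 * Suc k)) * fact (3 * Suc k)
    = (P - 1 - of_nat (Suc (Suc (3 * k)))) * ((P - 1 - of_nat (Suc (3 * k))) * ((P - 1 - of_nat (3 * k)) * X))"
    unfolding X_def by (simp only: binomial_fact_Suc n)
  also have "\<dots> = ((P - 3 * of_nat k - 1) * (P - 3 * of_nat k - 2)) * (P - 3 * of_nat (Suc k)) * X"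
    by (simp add: algebra_simps)
  also have "\<dots> = 27 * (of_nat N - of_nat k) * (A + of_nat k) * (1 - P / 3 + of_nat k) * X"
    unfolding A by (simp add: field_simps)
  also have "X = 27 ^ k * of_nat (N choose k) * fact k * pochhammer A k * pochhammer (1 - P / 3) k"
    using Suc unfolding X_def by simp
  also have "27 * (of_nat N - of_nat k) * (A + of_nat k) * (1 - P / 3 + of_nat k) *
      (27 ^ k * of_nat (N choose k) * fact k * pochhammer A k * pochhammer (1 - P / 3) k)
    = 27 ^ Suc k * ((of_nat N - of_nat k) * (of_nat (N choose k) * fact k))
      * pochhammer A (Suc k) * pochhammer (1 - P / 3) (Suc k)"
    by (simp only: pochhammer_Suc power_Suc mult_ac)
  also have "\<dots> = 27 ^ Suc k * of_nat (N choose Suc k) * fact (Suc k)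
      * pochhammer A (Suc k) * pochhammer (1 - P / 3) (Suc k)"
    unfolding binomial_fact_Suc[symmetric] by (simp only: mult_ac)
  finally show ?case .
qed simp

lemma almkvist_zudilin_eq: "of_int (almkvist_zudilin (p - 1)) = 3 ^ (p - 1) * sum t {..N}"
proof -
  have N: "(p - 1) div 3 = N" using p_cases by auto
  have "odd p" using prime_p p_gt_3 prime_odd_nat by simp
  then have even: "even (p - 1)" by simp
  have "of_int (almkvist_zudilin (p - 1)) = (\<Sum>k\<le>N. rat_of_nat (2 * k choose k) * of_nat (3 * k choose k)
      * of_nat (p - 1 choose (3 * k)) * of_nat ((p - 1 + k) choose k) * (-3) ^ (p - 1 - 3 * k))"
    unfolding almkvist_zudilin_def N by (simp add: atLeast0AtMost)
  also have "\<dots> = (\<Sum>k\<le>N. 3 ^ (p - 1) * t k)"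
  proof (intro sum.cong refl)
    fix k assume "k \<in> {..N}"
    then have k: "k \<le> N" "3 * k \<le> p - 1" using p_cases by auto
    have "(-3) ^ (p - 1 - 3 * k) * (-3) ^ (3 * k) = ((-3) ^ (p - 1) :: rat)"
      using k(2) by (metis le_add_diff_inverse2 power_add)
    \<comment> \<open>The signs of the summands thus come from \<open>(-3) ^ (3 * k)\<close> alone,
      whose \<open>27 ^ k\<close> cancels the one in \<open>binomial_three_k\<close>.\<close>
    also have "(-3) ^ (p - 1) = (3 ^ (p - 1) :: rat)" using even by simp
    also have "(-3) ^ (3 * k) = ((-1) ^ k * 27 ^ k :: rat)"
      unfolding power_mult by (simp flip: power_mult_distrib)
    finally have "(-3) ^ (p - 1 - 3 * k) * ((-1) ^ k * 27 ^ k) = (3 ^ (p - 1) :: rat)" .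
    then have "(-3) ^ (p - 1 - 3 * k) = (3 ^ (p - 1) / ((-1) ^ k * 27 ^ k) :: rat)"
      by (simp add: nonzero_eq_divide_eq)
    also have "\<dots> = 3 ^ (p - 1) * (-1) ^ k / 27 ^ k"
      by (cases "even k") simp_all
    finally have sign: "(-3) ^ (p - 1 - 3 * k) = (3 ^ (p - 1) * (-1) ^ k / 27 ^ k :: rat)" .
    have "rat_of_nat (p - 1) + 1 = P" using p_gt_3 by (simp add: of_nat_diff)
    then have top: "rat_of_nat ((p - 1 + k) choose k) = pochhammer P k / fact k"
      using binomial_add_eq_pochhammer[of "p - 1" k, where 'a = rat] by simp
    have "rat_of_nat (p - 1 choose (3 * k))
        = 27 ^ k * of_nat (N choose k) * fact k * pochhammer A k * pochhammer (1 - P / 3) k / fact (3 * k)"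
      using binomial_three_k[OF k(1)] by (simp add: nonzero_eq_divide_eq)
    then show "rat_of_nat (2 * k choose k) * of_nat (3 * k choose k)
      * of_nat (p - 1 choose (3 * k)) * of_nat ((p - 1 + k) choose k) * (-3) ^ (p - 1 - 3 * k) = 3 ^ (p - 1) * t k"
      unfolding sign top binomial_mult_eq_fact_divide t_def
      by (simp add: divide_simps) (simp add: power3_eq_cube mult_ac)
  qed
  finally show ?thesis by (simp add: sum_distrib_left)
qed

section \<open>Passage to the summable series and conclusion\<close>

lemma pochhammer_unit:
  assumes "k \<le> N" shows "pochhammer (1 + P / 3) k \<in> Up" "fact k \<in> Up"
proof -
  have i: "0 < i" "i < p" if "i \<in> {1..k}" for i using that assms p_cases by auto
  have "of_nat i + P / 3 \<in> Up" if "i \<in> {1..k}" for i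
    using add_p_mult_Up[OF of_nat_Up[OF i[OF that]], of "1 / 3"] by (simp add: divide_Zp)
  then show "pochhammer (1 + P / 3) k \<in> Up" unfolding pochhammer_one_plus by (rule prod_Up)
  have "fact k = (\<Prod>i=1..k. rat_of_nat i)" by (simp add: fact_prod)
  then show "fact k \<in> Up" using prod_Up[of "{1..k}" rat_of_nat] of_nat_Up i by simp
qed

text \<open>The quotient of the two terms is a product of factors \<open>1 - P^2 / (9 i^2)\<close>,
  hence 1 modulo \<open>p ^ 2\<close>. For \<open>k > 0\<close> the symbol \<open>(P)_k\<close>
  supplies the third power of \<open>p\<close>; for \<open>k = 0\<close> both terms are 1.\<close>

lemma t_cong:
  assumes "k \<le> N" shows "zcong 3 (t k) (t' k)"
proof (cases k)
  case 0
  then show ?thesis by (simp add: t_def t'_def)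
next
  case (Suc j)
  define E where "E = pochhammer (1 + P / 3) k"
  have E: "E \<in> Up" "fact k \<in> Up" using pochhammer_unit[OF assms] unfolding E_def by auto
  have i: "0 < i" "i < p" if "i \<in> {1..k}" for i using that assms p_cases by auto
  have "pochhammer (1 - P / 3) k * E / fact k ^ 2
      = (\<Prod>i=1..k. (of_nat i - P / 3) * (of_nat i + P / 3) / of_nat i ^ 2)"
    using pochhammer_one_plus[of "- (P / 3)" k]
    by (simp add: E_def pochhammer_one_plus fact_prod prod_dividef prod.distrib prod_power_distrib)
  also have "zcong 2 \<dots> (1 + P ^ 2 * (\<Sum>i=1..k. (- 1) / 9 * (1 / of_nat i ^ 2)))"
  proof (rule zcong_prod_first_order)
    fix l assume l: "l \<in> {1..k}"
    show "(- 1) / 9 * (1 / rat_of_nat l ^ 2) \<in> Zp"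
      using inverse_square_Zp[OF i[OF l]] by (intro mult_Zp[OF divide_Zp[OF uminus_Zp]]) simp_all
    have "(of_nat l - P / 3) * (of_nat l + P / 3) / of_nat l ^ 2 = 1 + P ^ 2 * ((- 1) / 9 * (1 / of_nat l ^ 2))"
      using i[OF l] by (simp add: field_simps power2_eq_square)
    then show "zcong 2 ((of_nat l - P / 3) * (of_nat l + P / 3) / of_nat l ^ 2) (1 + P ^ 2 * ((- 1) / 9 * (1 / of_nat l ^ 2)))"
      by simp
  qed simp_all
  finally obtain z where z: "z \<in> Zp" "pochhammer (1 - P / 3) k * E / fact k ^ 2
      = 1 + P ^ 2 * (\<Sum>i=1..k. (- 1) / 9 * (1 / of_nat i ^ 2)) + P ^ 2 * z" by (rule zcongE)
  define w where "w = (\<Sum>i=1..k. (- 1) / 9 * (1 / rat_of_nat i ^ 2)) + z"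
  have w: "w \<in> Zp" "pochhammer (1 - P / 3) k * E / fact k ^ 2 = 1 + P ^ 2 * w"
  proof -
    have "(\<Sum>i=1..k. (- 1) / 9 * (1 / rat_of_nat i ^ 2)) \<in> Zp"
    proof (rule sum_Zp)
      fix l assume l: "l \<in> {1..k}"
      show "(- 1) / 9 * (1 / rat_of_nat l ^ 2) \<in> Zp"
        using inverse_square_Zp[OF i[OF l]] by (intro mult_Zp[OF divide_Zp[OF uminus_Zp]]) simp_all
    qed
    then show "w \<in> Zp" unfolding w_def using z(1) by (rule add_Zp)
    show "pochhammer (1 - P / 3) k * E / fact k ^ 2 = 1 + P ^ 2 * w"
      unfolding z(2) w_def by (simp add: algebra_simps)
  qed
  \<comment> \<open>This is \<open>t' k\<close> with the leading factor \<open>P\<close> of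
    \<open>pochhammer P (Suc j)\<close> removed.\<close>
  define y where "y = (-1) ^ k * of_nat (N choose k) * pochhammer A k * pochhammer (P + 1) j / (fact k * E)"
  have t': "t' k = P * y"
    unfolding t'_def y_def E_def Suc pochhammer_rec[of P] by (simp add: mult_ac)
  have "t k = t' k * (pochhammer (1 - P / 3) k * E / fact k ^ 2)"
    using Up_nonzero[OF E(1)] unfolding t_def t'_def E_def[symmetric]
    by (simp add: field_simps power2_eq_square power3_eq_cube)
  also have "\<dots> = t' k + P ^ 3 * (y * w)"
    unfolding w(2) t' by (simp add: algebra_simps power2_eq_square power3_eq_cube)
  finally have "t k = t' k + P ^ 3 * (y * w)" .
  moreover have "A \<in> Zp" unfolding A_def by (intro add_Zp diff_Zp divide_Zp mult_Zp) simp_all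
  then have "pochhammer A k \<in> Zp" unfolding pochhammer_prod by (intro prod_Zp add_Zp) simp_all
  then have "y \<in> Zp"
    unfolding y_def using E pochhammer_of_nat[of "p + 1" j, where 'a = rat]
    by (intro divide_Zp mult_Zp mult_Up power_Zp uminus_Zp) (simp_all flip: of_nat_Suc add: add_ac)
  then have "y * w \<in> Zp" using w(1) by (rule mult_Zp)
  ultimately show ?thesis by (rule zcongI)
qed

text \<open>Saalschuetz with \<open>a = A\<close>, \<open>b = P\<close>, \<open>c = 1\<close>,
  divided by \<open>N! (e)_N\<close> to undo the clearing of denominators. The choice of
  \<open>A\<close> makes \<open>e = - P / 3 - N\<close>.\<close>

lemma sum_t': "sum t' {..N} = R"
proof -
  define e where "e = 1 - A - P"
  \<comment> \<open>The factors run from \<open>- P / 3 - N\<close> to \<open>- P / 3 - 1\<close>;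
    reverse their order and change signs.\<close>
  have e: "pochhammer e N = (-1) ^ N * pochhammer (1 + P / 3) N"
    using pochhammer_minus'[of "- 1 - P / 3" N] unfolding e_def A_def by (simp add: algebra_simps)
  have pos: "pochhammer (1 + P / 3) k > 0" for k by (intro pochhammer_pos) simp
  have "t' k = of_nat (N choose k) * pochhammer A k * pochhammer P k
      * pochhammer (1 + of_nat k) (N - k) * pochhammer (1 - A - P) (N - k) / (fact N * pochhammer e N)"
    if "k \<in> {..N}" for k
  proof -
    have k: "k \<le> N" using that by simp
    have "fact N = pochhammer (1 :: rat) (k + (N - k))" using k by (simp add: pochhammer_fact)
    then have 1: "fact N = fact k * pochhammer (1 + rat_of_nat k) (N - k)"
      unfolding pochhammer_product' by (simp add: pochhammer_fact)
    \<comment> \<open>The last \<open>k\<close> factors, reflected in the same way, give the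
      denominator \<open>(1 + P/3)_k\<close> of \<open>t' k\<close>.\<close>
    have "pochhammer e N = pochhammer e (N - k) * pochhammer (e + of_nat (N - k)) k"
      using pochhammer_product'[of e "N - k" k] k by simp
    also have "pochhammer (e + of_nat (N - k)) k = (-1) ^ k * pochhammer (1 + P / 3) k"
      using pochhammer_minus'[of "- 1 - P / 3" k] k unfolding e_def A_def
      by (simp add: algebra_simps of_nat_diff)
    finally have 2: "pochhammer e N = pochhammer e (N - k) * ((-1) ^ k * pochhammer (1 + P / 3) k)" .
    have nz: "pochhammer e (N - k) \<noteq> 0" "pochhammer (1 + rat_of_nat k) (N - k) \<noteq> 0" "pochhammer (1 + P / 3) k \<noteq> 0"
      using 2 e pos[of N] pos[of k] 1 by auto
    show ?thesis
      unfolding 1 2 e_def[symmetric] t'_def using nz by (cases "even k") (simp_all add: field_simps)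
  qed
  then have "sum t' {..N} = pochhammer (1 - A) N * pochhammer (1 - P) N / (fact N * pochhammer e N)"
    using saalschuetz[of N A P 1] by (simp add: sum_divide_distrib[symmetric])
  \<comment> \<open>Again a reflection, as \<open>1 - A = 2 * P / 3 - N\<close>; its sign cancels
    against that of \<open>(e)_N\<close>.\<close>
  also have "pochhammer (1 - A) N = (-1) ^ N * pochhammer (1 + - (2 * P / 3)) N"
    using pochhammer_minus'[of "2 * P / 3 - 1" N] unfolding A_def by (simp add: algebra_simps)
  also have "(-1) ^ N * pochhammer (1 + - (2 * P / 3)) N * pochhammer (1 - P) N / (fact N * pochhammer e N)
    = pochhammer (1 + - (2 * P / 3)) N * pochhammer (1 + - P) N / (fact N * pochhammer (1 + P / 3) N)"
    unfolding e by simp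
  also have "\<dots> = R"
    unfolding R_def pochhammer_one_plus fact_prod by (simp add: prod_dividef prod.distrib)
  finally show ?thesis .
qed

lemma almkvist_zudilin_cong: "[almkvist_zudilin (p - 1) = 81 ^ (p - 1)] (mod (int p ^ 3))"
proof (rule zcong_of_int)
  have "R \<in> Zp"
    unfolding R_def
  proof (intro prod_Zp divide_Zp)
    fix i assume i: "i \<in> {1..N}"
    show "(of_nat i - 2 * P / 3) * (of_nat i - P) \<in> Zp"
      by (intro mult_Zp diff_Zp divide_Zp) simp_all
    have "rat_of_nat i \<in> Up" using low_range[OF i] of_nat_Up by blast
    moreover have "of_nat i + P / 3 \<in> Up"
      using add_p_mult_Up[OF \<open>rat_of_nat i \<in> Up\<close>, of "1 / 3"] by (simp add: divide_Zp)
    ultimately show "of_nat i * (of_nat i + P / 3) \<in> Up" by (rule mult_Up)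
  qed
  moreover have "zcong 3 (sum t {..N}) R"
    unfolding sum_t'[symmetric] using t_cong by (intro zcong_sum) simp
  ultimately have "zcong 3 (sum t {..N} * 3 ^ (p - 1)) (R * 3 ^ (p - 1))"
    by (intro zcong_mult zcong_refl power_Zp const_Zp)
  from zcong_trans[OF this R_cong]
  show "zcong 3 (of_int (almkvist_zudilin (p - 1))) (of_int (81 ^ (p - 1)))"
    unfolding almkvist_zudilin_eq by (simp only: of_int_power of_int_numeral mult.commute)
qed

end

theorem theorem4p1:
  fixes p :: nat
  assumes "prime p" and "p > 3"
  shows "[almkvist_zudilin (p - 1) = 81 ^ (p - 1)] (mod (int p ^ 3))"
proof -
  interpret prime_gt_3 p using assms by unfold_locales
  show ?thesis by (rule almkvist_zudilin_cong)
qed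

end
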